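(* The following identities of formal power series in $z$ (with coefficients in $\mathbb{Z}[q]$) hold: $$\sum_{\sigma \in S(231,321)}q^{\mathrm{cr}(\sigma)}z^{|\sigma|}=\frac{1-qz}{1-(1+q)z-(1-q)z^2},$$ and, for each $\tau\in\{132,213\}$, $$\sum_{\sigma \in S(123,\tau)}q^{\mathrm{cr}(\sigma)}z^{|\sigma|}=1+\frac{(1-qz)z}{(1-z)(1-(1+q)z)}.$$
   Context: $S_n$ is the set of permutations $\sigma=\sigma(1)\cdots\sigma(n)$ of $[n]=\{1,\dots,n\}$ ($S_0$ consists of the empty permutation), and $|\sigma|=n$ for $\sigma\in S_n$. A crossing of $\sigma$ is a pair of indices $(i,j)$ such that $i<j<\sigma(i)<\sigma(j)$ or $\sigma(i)<\sigma(j)\leq i<j$; $\mathrm{cr}(\sigma)$ is the number of crossings of $\sigma$. A permutation $\sigma$ avoids a pattern $\tau\in S_m$ if there are no indices $i_1<\cdots<i_m$ such that $\sigma(i_1)\cdots\sigma(i_m)$ is order isomorphic to $\tau$. $S_n(\tau_1,\tau_2)$ is the set of $\sigma\in S_n$ avoiding both $\tau_1$ and $\tau_2$, and $S(\tau_1,\tau_2)=\bigcup_{n\ge 0}S_n(\tau_1,\tau_2)$. Patterns are written in one-line notation. *)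

theory Defs
  imports
    "HOL-Computational_Algebra.Computational_Algebra"
    "HOL-Combinatorics.Multiset_Permutations"
begin

(* A permutation is its one-line word, a list; lists count from 0, while the positions
   i in sigma(i) count from 1. *)
definition perms :: "nat \<Rightarrow> nat list set" where
  "perms n = permutations_of_set {1..n}"

definition val :: "nat list \<Rightarrow> nat \<Rightarrow> nat" where
  "val \<sigma> i = \<sigma> ! (i - 1)"

definition crossings :: "nat list \<Rightarrow> (nat \<times> nat) set" where
  "crossings \<sigma> = {(i, j). i \<in> {1..length \<sigma>} \<and> j \<in> {1..length \<sigma>} \<and>
     (i < j \<and> j < val \<sigma> i \<and> val \<sigma> i < val \<sigma> j \<or>
      val \<sigma> i < val \<sigma> j \<and> val \<sigma> j \<le> i \<and> i < j)}"

definition cr :: "nat list \<Rightarrow> nat" where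
  "cr \<sigma> = card (crossings \<sigma>)"

definition avoids :: "nat list \<Rightarrow> nat list \<Rightarrow> bool" where
  "avoids \<sigma> \<tau> \<longleftrightarrow> \<not> (\<exists>f. strict_mono_on {1..length \<tau>} f \<and>
     f ` {1..length \<tau>} \<subseteq> {1..length \<sigma>} \<and>
     (\<forall>a\<in>{1..length \<tau>}. \<forall>b\<in>{1..length \<tau>}.
        val \<sigma> (f a) < val \<sigma> (f b) \<longleftrightarrow> val \<tau> a < val \<tau> b))"

definition avoiders_n :: "nat \<Rightarrow> nat list \<Rightarrow> nat list \<Rightarrow> nat list set" where
  "avoiders_n n \<tau>1 \<tau>2 = {\<sigma> \<in> perms n. avoids \<sigma> \<tau>1 \<and> avoids \<sigma> \<tau>2}"

definition avoiders :: "nat list \<Rightarrow> nat list \<Rightarrow> nat list set" where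
  "avoiders \<tau>1 \<tau>2 = (\<Union>n. avoiders_n n \<tau>1 \<tau>2)"

abbreviation q :: "int poly" where
  "q \<equiv> [:0, 1:]"

definition cr_gf :: "nat list set \<Rightarrow> int poly fps" where
  "cr_gf A = Abs_fps (\<lambda>n. \<Sum>\<sigma> | \<sigma> \<in> A \<and> length \<sigma> = n. q ^ cr \<sigma>)"

(* Library division of formal power series needs an inverse operation on the coefficients,
   which int poly lacks. This quotient is meant for divisors with constant term 1. *)
definition fps_quot :: "'a::comm_ring_1 fps \<Rightarrow> 'a fps \<Rightarrow> 'a fps" where
  "fps_quot f g = f * fps_right_inverse g 1"

lemma mult_fps_quot:
  assumes "fps_nth g 0 = 1"
  shows "g * fps_quot f g = f"
  using fps_right_inverse[of g 1] assms
  by (simp add: fps_quot_def mult.left_commute[of g f])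

lemma fps_quot_unique:
  assumes "fps_nth g 0 = 1"
  shows "h = fps_quot f g \<longleftrightarrow> g * h = f"
proof
  assume gh: "g * h = f"
  have "fps_quot f g = (g * fps_right_inverse g 1) * h"
    unfolding fps_quot_def gh[symmetric] by (simp only: ac_simps)
  then show "h = fps_quot f g"
    using fps_right_inverse[of g 1] assms by simp
qed (simp add: mult_fps_quot assms)

lemma avoiders_length_eq: "{\<sigma> \<in> avoiders \<tau>1 \<tau>2. length \<sigma> = n} = avoiders_n n \<tau>1 \<tau>2"
  by (auto simp: avoiders_def avoiders_n_def perms_def length_finite_permutations_of_set)

lemma finite_avoiders_n: "finite (avoiders_n n \<tau>1 \<tau>2)"
  by (simp add: avoiders_n_def perms_def)

lemma finite_crossings: "finite (crossings \<sigma>)"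
  by (rule finite_subset[of _ "{1..length \<sigma>} \<times> {1..length \<sigma>}"])
    (auto simp: crossings_def)

end

theory Submission
  imports Defs
begin

text \<open>
  In a permutation that avoids 123 and 132, every entry has at most one larger entry to its right.
  Record the set \<open>D\<close> of the positions that have one. Such a permutation is determined by \<open>D\<close>,
  and every subset of \<open>{1..<n}\<close> occurs: at a position \<open>i\<close> in \<open>D\<close> exactly \<open>i\<close> entries are larger
  (all earlier ones and a single later one), so the value is \<open>n - i\<close>; at a position outside \<open>D\<close>,
  the larger entries fill the positions up to the nearest earlier position outside \<open>D\<close>
  (\<open>bij_betw_rise_word\<close>).

  The crossings of the permutation coded by \<open>D\<close> have their first index in \<open>D\<close>, at most one for each
  such index. List the positions from the middle outwards: \<open>n/2\<close>, \<open>n/2 - 1\<close>, \<open>n/2 + 1\<close>, ... for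
  even \<open>n\<close>. Then \<open>i\<close> in \<open>D\<close> starts a crossing iff some position listed before \<open>i\<close> lies outside
  \<open>D\<close> (\<open>cr_rise_word\<close>). So only the first position outside \<open>D\<close> in this order matters: after it,
  every position contributes a free factor \<open>1 + q\<close>. Hence the total weight is
  \<open>1 + (\<Sum>k<n-1. (1 + q)^k)\<close>, which is where the second generating function comes from; here it
  appears as the recurrence \<open>gap_sum_Suc\<close>.

  The other two classes are images of this one. Reflecting the permutation diagram in its
  antidiagonal preserves crossings and exchanges 132 with 213 (\<open>cr_antitranspose\<close>,
  \<open>avoids_antitranspose\<close>). Reversing the word turns 123 and 132 into 321 and 231. It changes the
  crossings, but they are again read off \<open>D\<close>: they correspond to the pairs of consecutive
  elements of \<open>D\<close> (\<open>cr_rev_rise_word\<close>), and counting subsets by such pairs satisfies a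
  linear recurrence of order two (\<open>pair_sum_Suc_Suc\<close>).
\<close>

section \<open>Permutations as words\<close>

lemma perms_iff:
  "\<sigma> \<in> perms n \<longleftrightarrow> length \<sigma> = n \<and> bij_betw (val \<sigma>) {1..n} {1..n}"
proof -
  have im: "val \<sigma> ` {1..n} = set \<sigma>" if "length \<sigma> = n"
  proof -
    have "val \<sigma> ` {1..n} = (!) \<sigma> ` ((\<lambda>i. i - 1) ` {1..n})"
      by (simp add: val_def image_image)
    also have "(\<lambda>i. i - 1) ` {1..n} = {..<n}"
      by (force simp: image_iff intro: bexI[of _ "Suc _"])
    also have "(!) \<sigma> ` {..<n} = set \<sigma>"
      using that by (auto simp: set_conv_nth)
    finally show ?thesis .
  qed
  show ?thesis
  proof
    assume "\<sigma> \<in> perms n"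
    then have s: "set \<sigma> = {1..n}" "distinct \<sigma>"
      by (auto simp: perms_def permutations_of_set_def)
    then have l: "length \<sigma> = n"
      using distinct_card[of \<sigma>] by simp
    have "inj_on (val \<sigma>) {1..n}"
      by (rule eq_card_imp_inj_on) (simp_all add: im[OF l, simplified] s)
    then show "length \<sigma> = n \<and> bij_betw (val \<sigma>) {1..n} {1..n}"
      using im[OF l] s l by (simp add: bij_betw_def)
  next
    assume a: "length \<sigma> = n \<and> bij_betw (val \<sigma>) {1..n} {1..n}"
    then have "set \<sigma> = {1..n}"
      using im by (simp add: bij_betw_def)
    moreover from this have "distinct \<sigma>"
      using a by (intro card_distinct) simp
    ultimately show "\<sigma> \<in> perms n"
      by (simp add: perms_def permutations_of_set_def)
  qed
qed

lemma perms_valD: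
  assumes "\<sigma> \<in> perms n"
  shows "length \<sigma> = n"
    and "i \<in> {1..n} \<Longrightarrow> val \<sigma> i \<in> {1..n}"
    and "\<lbrakk>i \<in> {1..n}; j \<in> {1..n}\<rbrakk> \<Longrightarrow> val \<sigma> i = val \<sigma> j \<longleftrightarrow> i = j"
  using assms unfolding perms_iff bij_betw_def
  by (blast, blast, meson inj_on_eq_iff)

lemma val_ext:
  assumes "length \<sigma> = n" "length \<tau> = n" "\<And>i. i \<in> {1..n} \<Longrightarrow> val \<sigma> i = val \<tau> i"
  shows "\<sigma> = \<tau>"
proof (rule nth_equalityI)
  fix i assume "i < length \<sigma>"
  then show "\<sigma> ! i = \<tau> ! i"
    using assms(3)[of "Suc i"] assms(1) by (simp add: val_def)
qed (simp add: assms)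

lemma val_map_upt: "i \<in> {1..n} \<Longrightarrow> val (map f [1..<Suc n]) i = f i"
  by (auto simp: val_def nth_map_upt simp del: upt_Suc)

lemma val_rev: "i \<in> {1..length \<sigma>} \<Longrightarrow> val (rev \<sigma>) i = val \<sigma> (Suc (length \<sigma>) - i)"
  by (auto simp: val_def rev_nth Suc_diff_le)

lemma rev_perms: "rev \<sigma> \<in> perms n \<longleftrightarrow> \<sigma> \<in> perms n"
  by (simp add: perms_def permutations_of_set_def)

section \<open>Avoiding pairs of patterns\<close>

text \<open>
An increasing choice of three positions is a triple \<open>i < j < k\<close>. All strict comparisons are kept as
equivalences, because a word with repeated values may have ties that the pattern lacks.
\<close>

lemma avoids_length3:
  "avoids \<sigma> [a, b, c] \<longleftrightarrow> (\<forall>i j k. \<not> (1 \<le> i \<and> i < j \<and> j < k \<and> k \<le> length \<sigma> \<and>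
     (val \<sigma> i < val \<sigma> j \<longleftrightarrow> a < b) \<and> (val \<sigma> j < val \<sigma> i \<longleftrightarrow> b < a) \<and>
     (val \<sigma> i < val \<sigma> k \<longleftrightarrow> a < c) \<and> (val \<sigma> k < val \<sigma> i \<longleftrightarrow> c < a) \<and>
     (val \<sigma> j < val \<sigma> k \<longleftrightarrow> b < c) \<and> (val \<sigma> k < val \<sigma> j \<longleftrightarrow> c < b)))"
    (is "_ \<longleftrightarrow> (\<forall>i j k. \<not> ?occ i j k)")
proof -
  have three: "{1..length [a, b, c]} = {1, 2, 3}"
    by auto
  have v: "val [x, y, z] 1 = x" "val [x, y, z] 2 = y" "val [x, y, z] 3 = z" for x y z
    by (simp_all add: val_def)
  have occ: "strict_mono_on {1, 2, 3} f \<and> f ` {1, 2, 3} \<subseteq> {1..length \<sigma>} \<and>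
      (\<forall>x\<in>{1, 2, 3}. \<forall>y\<in>{1, 2, 3}.
         val \<sigma> (f x) < val \<sigma> (f y) \<longleftrightarrow> val [a, b, c] x < val [a, b, c] y)
      \<longleftrightarrow> ?occ (f 1) (f 2) (f 3)" for f :: "nat \<Rightarrow> nat"
  proof -
    have m: "strict_mono_on {1, 2, 3} f \<longleftrightarrow> f 1 < f 2 \<and> f 2 < f 3"
    proof
      assume "f 1 < f 2 \<and> f 2 < f 3"
      then show "strict_mono_on {1, 2, 3} f"
        unfolding strict_mono_on_def by auto
    qed (auto simp: strict_mono_on_def)
    have im: "f ` {1, 2, 3} \<subseteq> {1..length \<sigma>} \<longleftrightarrow> 1 \<le> f 1 \<and> f 3 \<le> length \<sigma>"
      if "f 1 < f 2 \<and> f 2 < f 3"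
      using that by auto
    show ?thesis
    proof (cases "f 1 < f 2 \<and> f 2 < f 3")
      case True
      show ?thesis
        by (simp only: m im[OF True] True[THEN conjunct1] True[THEN conjunct2]
            ball_simps v less_irrefl simp_thms conj_ac)
    qed (auto simp only: m)
  qed
  have ex3: "(\<exists>f :: nat \<Rightarrow> nat. Q (f 1) (f 2) (f 3)) \<longleftrightarrow> (\<exists>i j k. Q i j k)"
    for Q :: "nat \<Rightarrow> nat \<Rightarrow> nat \<Rightarrow> bool"
  proof
    assume "\<exists>i j k. Q i j k"
    then obtain i j k where "Q i j k" by blast
    then show "\<exists>f :: nat \<Rightarrow> nat. Q (f 1) (f 2) (f 3)"
      by (intro exI[of _ "val [i, j, k]"]) (simp only: v)
  qed blast
  show ?thesis
    unfolding avoids_def three occ ex3[of ?occ] not_ex ..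
qed

text \<open>
Two larger entries to the right of an entry form 123 or 132 with it, according to their relative order.
\<close>

lemma avoiders_123_132:
  "avoiders_n n [1, 2, 3] [1, 3, 2] = {\<sigma> \<in> perms n. \<forall>i j k. 1 \<le> i \<longrightarrow>
     i < j \<longrightarrow> j \<le> n \<longrightarrow> val \<sigma> i < val \<sigma> j \<longrightarrow>
     i < k \<longrightarrow> k \<le> n \<longrightarrow> val \<sigma> i < val \<sigma> k \<longrightarrow> j = k}"
proof -
  have "avoids \<sigma> [1, 2, 3] \<and> avoids \<sigma> [1, 3, 2] \<longleftrightarrow> (\<forall>i j k. 1 \<le> i \<longrightarrow>
     i < j \<longrightarrow> j \<le> n \<longrightarrow> val \<sigma> i < val \<sigma> j \<longrightarrow>
     i < k \<longrightarrow> k \<le> n \<longrightarrow> val \<sigma> i < val \<sigma> k \<longrightarrow> j = k)" (is "?l \<longleftrightarrow> ?r")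
    if p: "\<sigma> \<in> perms n" for \<sigma>
  proof
    assume r: ?r
    have no: "\<not> (1 \<le> i \<and> i < j \<and> j < k \<and> k \<le> n \<and> val \<sigma> i < val \<sigma> j \<and> val \<sigma> i < val \<sigma> k)" for i j k
      using r[rule_format, of i j k] by auto
    show ?l
      unfolding avoids_length3 perms_valD(1)[OF p] by (intro conjI allI; use no in force)
  next
    assume l: ?l
    have no: "False" if "1 \<le> i" "i < j" "j < k" "k \<le> n" "val \<sigma> i < val \<sigma> j" "val \<sigma> i < val \<sigma> k" for i j k
    proof -
      have "val \<sigma> j < val \<sigma> k \<or> val \<sigma> k < val \<sigma> j"
        using that perms_valD(3)[OF p, of j k] by auto
      then show False
        using that conjunct1[OF l, unfolded avoids_length3 perms_valD(1)[OF p], rule_format, of i j k]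
          conjunct2[OF l, unfolded avoids_length3 perms_valD(1)[OF p], rule_format, of i j k]
        by auto
    qed
    show ?r
    proof (intro allI impI)
      fix i j k assume "1 \<le> i" "i < j" "j \<le> n" "val \<sigma> i < val \<sigma> j" "i < k" "k \<le> n" "val \<sigma> i < val \<sigma> k"
      then show "j = k"
        using no[of i j k] no[of i k j] by (cases j k rule: linorder_cases) auto
    qed
  qed
  then show ?thesis
    unfolding avoiders_n_def by blast
qed

section \<open>Avoiders of 123 and 132 are coded by subsets\<close>

definition rise_set :: "nat list \<Rightarrow> nat set" where
  "rise_set \<sigma> = {i. 1 \<le> i \<and> (\<exists>j. i < j \<and> j \<le> length \<sigma> \<and> val \<sigma> i < val \<sigma> j)}"

text \<open>
For \<open>0 < i\<close> and \<open>0 \<notin> D\<close> the set is nonempty. The value is 0 when all of \<open>{1..<i}\<close> lies in \<open>D\<close>, so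
position 0 serves as a sentinel outside \<open>D\<close>.
\<close>

definition prev_gap :: "nat set \<Rightarrow> nat \<Rightarrow> nat" where
  "prev_gap D i = Max {p. p < i \<and> p \<notin> D}"

text \<open>
The subtrahend is the number of entries larger than the one at position \<open>i\<close>.
\<close>

definition rise_val :: "nat \<Rightarrow> nat set \<Rightarrow> nat \<Rightarrow> nat" where
  "rise_val n D i = n - (if i \<in> D then i else prev_gap D i)"

definition rise_word :: "nat \<Rightarrow> nat set \<Rightarrow> nat list" where
  "rise_word n D = map (rise_val n D) [1..<Suc n]"

lemma prev_gap:
  assumes "0 \<notin> D" "0 < i"
  shows "prev_gap D i < i" "prev_gap D i \<notin> D"
    and "p < i \<Longrightarrow> p \<notin> D \<Longrightarrow> p \<le> prev_gap D i"
proof -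
  let ?A = "{p. p < i \<and> p \<notin> D}"
  have "finite ?A" "?A \<noteq> {}"
    using assms by auto
  then have "Max ?A \<in> ?A" "p < i \<Longrightarrow> p \<notin> D \<Longrightarrow> p \<le> Max ?A"
    by (rule Max_in, simp)
  then show "prev_gap D i < i" "prev_gap D i \<notin> D" "p < i \<Longrightarrow> p \<notin> D \<Longrightarrow> p \<le> prev_gap D i"
    unfolding prev_gap_def by blast+
qed

text \<open>
The word of \<open>D\<close> is a decreasing sequence of blocks, each ending at a position outside \<open>D\<close>: within a
block the entries decrease, except for the last one, which exceeds all others. So the pairs of positions
in increasing order of value join an element of \<open>D\<close> to the end of its block.
\<close>

lemma rise_val_less_iff:
  assumes D: "D \<subseteq> {1..<n}" and ij: "1 \<le> i" "i < j" "j \<le> n"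
  shows "rise_val n D i < rise_val n D j \<longleftrightarrow> i \<in> D \<and> j \<notin> D \<and> prev_gap D j < i"
proof -
  have "0 \<notin> D" using D by auto
  note pi = prev_gap[OF this, of i] and pj = prev_gap[OF this, of j]
  show ?thesis
    using pi(1) pj(1) pj(3)[of i] ij by (auto simp: rise_val_def)
qed

lemma length_rise_word: "length (rise_word n D) = n"
  by (simp add: rise_word_def del: upt_Suc)

lemma val_rise_word: "1 \<le> i \<Longrightarrow> i \<le> n \<Longrightarrow> val (rise_word n D) i = rise_val n D i"
  unfolding rise_word_def by (rule val_map_upt) simp

lemma rise_word_perms:
  assumes D: "D \<subseteq> {1..<n}"
  shows "rise_word n D \<in> perms n"
proof -
  have 0: "0 \<notin> D" using D by auto
  note g = prev_gap[OF 0]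
  have ran: "rise_val n D i \<in> {1..n}" if "i \<in> {1..n}" for i
    using g(1)[of i] that D by (auto simp: rise_val_def)
  have neq: "rise_val n D i \<noteq> rise_val n D j" if "1 \<le> i" "i < j" "j \<le> n" for i j
  proof -
    have "prev_gap D i < i" "prev_gap D j < j" "prev_gap D i \<notin> D" "prev_gap D j \<notin> D"
      "i \<notin> D \<Longrightarrow> i \<le> prev_gap D j"
      using g[of i] g[of j] that by auto
    moreover have "i \<noteq> prev_gap D j" if "i \<in> D"
      using that calculation by metis
    moreover have "prev_gap D i \<noteq> j" "prev_gap D i \<noteq> prev_gap D j" if "i \<notin> D"
      using that calculation \<open>i < j\<close> by linarith+
    moreover have "i \<in> D \<Longrightarrow> i < n" "j \<in> D \<Longrightarrow> j < n"
      using D by auto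
    ultimately show ?thesis
      using that by (auto simp: rise_val_def)
  qed
  have "inj_on (rise_val n D) {1..n}"
    by (rule linorder_inj_onI) (use neq in auto)
  moreover from this have "rise_val n D ` {1..n} = {1..n}"
    using ran by (intro endo_inj_surj) auto
  ultimately have "bij_betw (val (rise_word n D)) {1..n} {1..n}"
    by (subst bij_betw_cong[where g = "rise_val n D"]) (simp_all add: bij_betw_def val_rise_word)
  then show ?thesis
    by (simp add: perms_iff length_rise_word)
qed

text \<open>
The end of the block of \<open>i\<close>. It exists because \<open>n\<close> lies outside \<open>D\<close>.
\<close>

lemma next_gap:
  fixes i n :: nat
  assumes D: "D \<subseteq> {1..<n}" and i: "i \<in> D"
  obtains j where "i < j" "j \<le> n" "j \<notin> D" "prev_gap D j < i"
    and "\<And>e. i < e \<Longrightarrow> e \<notin> D \<Longrightarrow> j \<le> e"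
proof -
  let ?j = "LEAST j. i < j \<and> j \<notin> D"
  have n: "i < n \<and> n \<notin> D"
    using D i by auto
  have j: "i < ?j \<and> ?j \<notin> D"
    by (rule LeastI[of _ n]) (rule n)
  have least: "?j \<le> e" if "i < e" "e \<notin> D" for e
    by (rule Least_le) (use that in simp)
  have "0 \<notin> D" using D by auto
  then have p: "prev_gap D ?j < ?j" "prev_gap D ?j \<notin> D"
    using prev_gap[of D ?j] j by auto
  then have "prev_gap D ?j < i"
    using least[of "prev_gap D ?j"] i by (metis leD linorder_neqE_nat)
  then show ?thesis
    using that[of ?j] j least n by blast
qed

lemma rise_set_rise_word:
  assumes D: "D \<subseteq> {1..<n}"
  shows "rise_set (rise_word n D) = D"
proof (intro equalityI subsetI)
  fix i assume "i \<in> rise_set (rise_word n D)"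
  then obtain j where "1 \<le> i" "i < j" "j \<le> n" "rise_val n D i < rise_val n D j"
    by (auto simp: rise_set_def length_rise_word val_rise_word)
  then show "i \<in> D"
    using rise_val_less_iff[OF D] by blast
next
  fix i assume i: "i \<in> D"
  then obtain j where "i < j" "j \<le> n" "j \<notin> D" "prev_gap D j < i"
    using next_gap[OF D i] by metis
  moreover have "1 \<le> i"
    using D i by auto
  ultimately show "i \<in> rise_set (rise_word n D)"
    using rise_val_less_iff[OF D, of i j] i
    by (auto simp: rise_set_def length_rise_word val_rise_word)
qed

lemma rise_word_avoids:
  assumes D: "D \<subseteq> {1..<n}"
  shows "rise_word n D \<in> avoiders_n n [1, 2, 3] [1, 3, 2]"
proof -
  have *: False if "1 \<le> i" "i < j" "j < k" "k \<le> n"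
    "rise_val n D i < rise_val n D j" "rise_val n D i < rise_val n D k" for i j k
  proof -
    have "j \<notin> D" "prev_gap D k < i"
      using that rise_val_less_iff[OF D, of i j] rise_val_less_iff[OF D, of i k] by auto
    moreover have "0 \<notin> D" using D by auto
    ultimately show False
      using prev_gap(3)[of D k j] that by simp
  qed
  have "j = k" if "1 \<le> i" "i < j" "j \<le> n" "rise_val n D i < rise_val n D j"
     "i < k" "k \<le> n" "rise_val n D i < rise_val n D k" for i j k
    using *[of i j k] *[of i k j] that by (cases j k rule: linorder_cases) auto
  then show ?thesis
    unfolding avoiders_123_132 using rise_word_perms[OF D] by (auto simp: val_rise_word)
qed

text \<open>
The value at a position is \<open>n\<close> minus the number of larger entries. For a position in the rise set
these are all earlier entries and the unique larger later one; for any other position \<open>i\<close> they are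
the entries up to the nearest earlier position \<open>p\<close> outside the rise set. Indeed the entry at \<open>p\<close>
exceeds that at \<open>i\<close>, an entry before \<open>p\<close> cannot be smaller than both, and an entry strictly
between is smaller than that at \<open>i\<close>.
\<close>

lemma rise_word_rise_set:
  assumes av: "\<sigma> \<in> avoiders_n n [1, 2, 3] [1, 3, 2]"
  shows "rise_word n (rise_set \<sigma>) = \<sigma>"
proof -
  let ?D = "rise_set \<sigma>"
  have p: "\<sigma> \<in> perms n"
    and uniq: "\<And>i j k. \<lbrakk>1 \<le> i; i < j; j \<le> n; val \<sigma> i < val \<sigma> j; i < k; k \<le> n; val \<sigma> i < val \<sigma> k\<rbrakk> \<Longrightarrow> j = k"
    using av unfolding avoiders_123_132 by blast+
  note len = perms_valD(1)[OF p]
  have bij: "bij_betw (val \<sigma>) {1..n} {1..n}"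
    using p by (simp add: perms_iff)
  have 0: "0 \<notin> ?D" by (simp add: rise_set_def)
  have larger: "card {k \<in> {1..n}. val \<sigma> i < val \<sigma> k} = n - val \<sigma> i" if "i \<in> {1..n}" for i
  proof -
    have "bij_betw (val \<sigma>) {k \<in> {1..n}. val \<sigma> i < val \<sigma> k} {v \<in> {1..n}. val \<sigma> i < v}"
      using bij by (rule bij_betw_Collect) auto
    moreover have "{v \<in> {1..n}. val \<sigma> i < v} = {Suc (val \<sigma> i)..n}"
      using perms_valD(2)[OF p that] by auto
    ultimately show ?thesis
      by (simp add: bij_betw_same_card)
  qed
  have in_D: "val \<sigma> i = n - i" if i: "i \<in> ?D" for i
  proof -
    obtain j where j: "1 \<le> i" "i < j" "j \<le> n" "val \<sigma> i < val \<sigma> j"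
      using i by (auto simp: rise_set_def len)
    \<comment> \<open>a smaller earlier entry would lie below both \<open>val \<sigma> i\<close> and \<open>val \<sigma> j\<close>\<close>
    have earlier: "val \<sigma> i < val \<sigma> k" if k: "1 \<le> k" "k < i" for k
    proof (rule ccontr)
      assume "\<not> ?thesis"
      then have "val \<sigma> k < val \<sigma> i"
        using perms_valD(3)[OF p, of k i] k j by auto
      then show False
        using uniq[of k i j] k j by auto
    qed
    have "{k \<in> {1..n}. val \<sigma> i < val \<sigma> k} = insert j {1..<i}"
    proof (intro equalityI subsetI)
      fix k assume "k \<in> {k \<in> {1..n}. val \<sigma> i < val \<sigma> k}"
      then show "k \<in> insert j {1..<i}"
        using uniq[OF j, of k] by (cases k i rule: linorder_cases) auto
    qed (use earlier j in auto)
    then have "card {k \<in> {1..n}. val \<sigma> i < val \<sigma> k} = i"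
      using j by simp
    then show ?thesis
      using larger[of i] j perms_valD(2)[OF p, of i] by auto
  qed
  have not_in_D: "val \<sigma> i = n - prev_gap ?D i" if i: "1 \<le> i" "i \<le> n" "i \<notin> ?D" for i
  proof -
    let ?p = "prev_gap ?D i"
    have g: "?p < i" "?p \<notin> ?D" "\<And>k. ?p < k \<Longrightarrow> k < i \<Longrightarrow> k \<in> ?D"
      using prev_gap[OF 0, of i] i by (auto simp: not_le[symmetric])
    have later: "val \<sigma> k < val \<sigma> l" if "1 \<le> l" "l < k" "k \<le> n" "l \<notin> ?D" for k l
      using that perms_valD(3)[OF p, of k l] by (force simp: rise_set_def len)
    have before: "val \<sigma> i < val \<sigma> k" if k: "1 \<le> k" "k \<le> ?p" for k
    proof (cases "k = ?p")
      case True
      then show ?thesis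
        using later[of ?p i] k g i by simp
    next
      case False
      have "val \<sigma> i < val \<sigma> ?p"
        using later[of ?p i] k g i by simp
      then show ?thesis
        using uniq[of k ?p i] perms_valD(3)[OF p, of k i] False k g(1) i by force
    qed
    \<comment> \<open>otherwise the larger later entry, at \<open>j\<close>, would also lie before \<open>i\<close>, so \<open>k\<close> and \<open>j\<close> would both
      lie in the rise set, where the values \<open>n - k\<close> and \<open>n - j\<close> decrease\<close>
    have between: "\<not> val \<sigma> i < val \<sigma> k" if k: "?p < k" "k < i" for k
    proof
      assume less: "val \<sigma> i < val \<sigma> k"
      obtain j where j: "k < j" "j \<le> n" "val \<sigma> k < val \<sigma> j"
        using g(3)[OF k] by (auto simp: rise_set_def len)
      then have "j < i"
        using later[of i j] less i by (cases i j rule: linorder_cases) auto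
      then have "val \<sigma> j = n - j" "val \<sigma> k = n - k"
        using in_D g(3) k j by auto
      then show False
        using j by simp
    qed
    have "{k \<in> {1..n}. val \<sigma> i < val \<sigma> k} = {1..?p}"
    proof (intro equalityI subsetI)
      fix k assume k: "k \<in> {k \<in> {1..n}. val \<sigma> i < val \<sigma> k}"
      then have "k < i"
        using later[of i k] i by (cases k i rule: linorder_cases) auto
      then show "k \<in> {1..?p}"
        using between[of k] k by (auto simp: not_less[symmetric])
    qed (use before g(1) i in auto)
    then show ?thesis
      using larger[of i] i perms_valD(2)[OF p, of i] by auto
  qed
  show ?thesis
  proof (rule val_ext)
    fix i assume "i \<in> {1..n}"
    then show "val (rise_word n ?D) i = val \<sigma> i"
      using in_D[of i] not_in_D[of i] by (auto simp: val_rise_word rise_val_def)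
  qed (simp_all add: length_rise_word len)
qed

lemma rise_set_subset: "rise_set \<sigma> \<subseteq> {1..<length \<sigma>}"
  by (auto simp: rise_set_def)

lemma bij_betw_rise_word:
  "bij_betw (rise_word n) (Pow {1..<n}) (avoiders_n n [1, 2, 3] [1, 3, 2])"
proof (rule bij_betw_byWitness[where f' = rise_set])
  show "rise_set ` avoiders_n n [1, 2, 3] [1, 3, 2] \<subseteq> Pow {1..<n}"
    using rise_set_subset by (force simp: avoiders_n_def dest: perms_valD(1))
qed (use rise_set_rise_word rise_word_rise_set rise_word_avoids in auto)

section \<open>Crossings in terms of the coding subset\<close>

text \<open>
The index of \<open>i\<close> in the list of \<open>{1..<n}\<close> from the middle outwards. Among two positions \<open>i\<close> and
\<open>n - i\<close> at equal distance from \<open>n / 2\<close>, the left one comes first.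
\<close>

definition mid_rank :: "nat \<Rightarrow> nat \<Rightarrow> nat" where
  "mid_rank n i = (if n \<le> 2 * i then 2 * i - n else n - 2 * i - 1)"

text \<open>
The positions listed before \<open>i\<close> form an interval about the middle that stops just short of \<open>i\<close>.
At most one of the two alternatives is possible for a given \<open>i\<close>.
\<close>

lemma mid_rank_less_iff:
  assumes "i < n" "e < n"
  shows "mid_rank n e < mid_rank n i \<longleftrightarrow> i < e \<and> e < n - i \<or> n - i \<le> e \<and> e < i"
  using assms by (auto simp: mid_rank_def)

lemma bij_betw_mid_rank: "bij_betw (mid_rank n) {1..<n} {..<n - 1}"
proof -
  have "inj_on (mid_rank n) {1..<n}"
    by (rule inj_onI) (simp add: mid_rank_def split: if_splits; presburger)
  moreover have "mid_rank n ` {1..<n} \<subseteq> {..<n - 1}"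
    by (auto simp: mid_rank_def)
  ultimately have "mid_rank n ` {1..<n} = {..<n - 1}"
    by (intro card_subset_eq) (simp_all add: card_image)
  with \<open>inj_on (mid_rank n) {1..<n}\<close> show ?thesis
    by (simp add: bij_betw_def)
qed

text \<open>
By \<open>rise_val_less_iff\<close> a crossing joins \<open>i\<close> in \<open>D\<close> to the end \<open>j\<close> of its block. With values
\<open>n - i\<close> and \<open>n - p\<close>, where \<open>p\<close> is the end of the preceding block, it is a crossing iff
\<open>j < n - i\<close> or \<open>n - i \<le> p\<close>. Since \<open>j\<close> and \<open>p\<close> are the positions outside \<open>D\<close> that are nearest to \<open>i\<close>,
this says that some position outside \<open>D\<close> lies in \<open>{i<..<n - i}\<close> or in \<open>{n - i..<i}\<close>, and those are the
positions of smaller rank.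
\<close>

lemma cr_rise_word:
  assumes D: "D \<subseteq> {1..<n}"
  shows "cr (rise_word n D) = card {i \<in> D. \<exists>e\<in>{1..<n} - D. mid_rank n e < mid_rank n i}"
proof -
  let ?C = "crossings (rise_word n D)"
  have 0: "0 \<notin> D" using D by auto
  note g = prev_gap[OF 0]
  have cross: "(i, j) \<in> ?C \<longleftrightarrow> i \<in> D \<and> i < j \<and> j \<le> n \<and> j \<notin> D \<and> prev_gap D j < i \<and>
      (j < n - i \<or> n - prev_gap D j \<le> i)" for i j
  proof -
    have "(i, j) \<in> ?C \<longleftrightarrow> 1 \<le> i \<and> i < j \<and> j \<le> n \<and> rise_val n D i < rise_val n D j \<and>
        (j < rise_val n D i \<or> rise_val n D j \<le> i)"
    proof (cases "1 \<le> i \<and> i < j \<and> j \<le> n")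
      case True
      then show ?thesis
        using val_rise_word[of i n D] val_rise_word[of j n D]
        by (auto simp: crossings_def length_rise_word)
    qed (auto simp: crossings_def length_rise_word)
    also have "\<dots> \<longleftrightarrow> i \<in> D \<and> i < j \<and> j \<le> n \<and> j \<notin> D \<and> prev_gap D j < i \<and>
      (j < n - i \<or> n - prev_gap D j \<le> i)"
      using rise_val_less_iff[OF D, of i j] D by (auto simp: rise_val_def)
    finally show ?thesis .
  qed
  have "inj_on fst ?C"
  proof (rule inj_onI)
    fix x y assume xy: "x \<in> ?C" "y \<in> ?C" "fst x = fst y"
    obtain i j k where x: "x = (i, j)" and y: "y = (i, k)"
      using xy(3) by (metis prod.collapse)
    have "j = k"
      using xy(1,2) g(3)[of j k] g(3)[of k j] unfolding x y cross
      by (cases j k rule: linorder_cases) auto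
    then show "x = y"
      by (simp add: x y)
  qed
  then have "cr (rise_word n D) = card (fst ` ?C)"
    by (simp add: cr_def card_image)
  also have "fst ` ?C = {i \<in> D. \<exists>e\<in>{1..<n} - D. mid_rank n e < mid_rank n i}"
  proof (intro equalityI subsetI)
    fix i assume "i \<in> fst ` ?C"
    then obtain j where ij: "i \<in> D" "i < j" "j \<le> n" "j \<notin> D" "prev_gap D j < i"
      and c: "j < n - i \<or> n - prev_gap D j \<le> i"
      using cross by auto
    have i: "1 \<le> i" "i < n"
      using D ij(1) by auto
    from c have "\<exists>e\<in>{1..<n} - D. i < e \<and> e < n - i \<or> n - i \<le> e \<and> e < i"
    proof
      assume "j < n - i"
      then show ?thesis
        using ij by (intro bexI[of _ j]) auto
    next
      assume "n - prev_gap D j \<le> i"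
      then show ?thesis
        using ij i g(2)[of j] by (intro bexI[of _ "prev_gap D j"]) auto
    qed
    then show "i \<in> {i \<in> D. \<exists>e\<in>{1..<n} - D. mid_rank n e < mid_rank n i}"
      using ij(1) i mid_rank_less_iff by auto
  next
    fix i assume "i \<in> {i \<in> D. \<exists>e\<in>{1..<n} - D. mid_rank n e < mid_rank n i}"
    then obtain e where i: "i \<in> D" and e: "1 \<le> e" "e < n" "e \<notin> D" "mid_rank n e < mid_rank n i"
      by auto
    obtain j where j: "i < j" "j \<le> n" "j \<notin> D" "prev_gap D j < i"
      and least: "\<And>e. i < e \<Longrightarrow> e \<notin> D \<Longrightarrow> j \<le> e"
      using next_gap[OF D i] by metis
    have "i < e \<and> e < n - i \<or> n - i \<le> e \<and> e < i"
      using D i e mid_rank_less_iff[of i n e] by auto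
    then have "j < n - i \<or> n - prev_gap D j \<le> i"
      using least[of e] g(3)[of j e] e(3) j(1) by auto
    then have "(i, j) \<in> ?C"
      using i j cross by simp
    then show "i \<in> fst ` ?C"
      by force
  qed
  finally show ?thesis .
qed

text \<open>
The reversed word is an increasing sequence of blocks. Each block starts with its largest value, which
is also its last position; the entries that follow it in the block come from \<open>D\<close> and are one less than
their positions. A crossing above the diagonal is impossible: the first of its two entries starts a
block, a larger later entry lies in a later block, and so its position exceeds the first value. A
crossing below the diagonal forces two consecutive positions, both from \<open>D\<close>.
\<close>

lemma cr_rev_rise_word:
  assumes D: "D \<subseteq> {1..<n}"
  shows "cr (rev (rise_word n D)) = card {i. i \<in> D \<and> Suc i \<in> D}"
proof -
  let ?C = "crossings (rev (rise_word n D))"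
  let ?f = "\<lambda>i. (n - i, Suc n - i)"
  have 0: "0 \<notin> D" using D by auto
  note g = prev_gap[OF 0]
  have cross: "(Suc n - b, Suc n - a) \<in> ?C \<longleftrightarrow> b = Suc a \<and> a \<in> D \<and> b \<in> D"
    if ab: "1 \<le> a" "a < b" "b \<le> n" for a b
  proof -
    have v: "val (rev (rise_word n D)) (Suc n - i) = rise_val n D i" if "1 \<le> i" "i \<le> n" for i
      using that by (subst val_rev) (auto simp: length_rise_word val_rise_word)
    have "(Suc n - b, Suc n - a) \<in> ?C \<longleftrightarrow>
        Suc n - a < rise_val n D b \<and> rise_val n D b < rise_val n D a \<or>
        rise_val n D b < rise_val n D a \<and> rise_val n D a \<le> Suc n - b"
      using ab by (auto simp: crossings_def length_rise_word v)
    also have "\<dots> \<longleftrightarrow> b = Suc a \<and> a \<in> D \<and> b \<in> D"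
    proof -
      have "\<not> (Suc n - a < rise_val n D b \<and> rise_val n D b < rise_val n D a)"
      proof
        assume *: "Suc n - a < rise_val n D b \<and> rise_val n D b < rise_val n D a"
        then have "b \<notin> D" and "Suc (prev_gap D b) < a"
          using ab by (auto simp: rise_val_def split: if_splits)
        then have "a \<in> D"
          using g(3)[of b a] ab by auto
        then show False
          using * ab \<open>b \<notin> D\<close> \<open>Suc (prev_gap D b) < a\<close> by (auto simp: rise_val_def)
      qed
      moreover have "rise_val n D b < rise_val n D a \<and> rise_val n D a \<le> Suc n - b \<longleftrightarrow>
          b = Suc a \<and> a \<in> D \<and> b \<in> D"
        using ab g(1)[of a] g(1)[of b] g(3)[of b a] D by (auto simp: rise_val_def)
      ultimately show ?thesis
        by blast
    qed
    finally show ?thesis .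
  qed
  have "?C = ?f ` {i. i \<in> D \<and> Suc i \<in> D}"
  proof (intro equalityI subsetI)
    fix x assume x: "x \<in> ?C"
    obtain k l where kl: "x = (k, l)"
      by (cases x)
    then have "1 \<le> k" "k < l" "l \<le> n"
      using x by (auto simp: crossings_def length_rise_word)
    then have "Suc n - l \<in> D \<and> Suc (Suc n - l) \<in> D" "Suc n - k = Suc (Suc n - l)"
      using cross[of "Suc n - l" "Suc n - k"] x kl by auto
    moreover from this have "x = ?f (Suc n - l)"
      using kl \<open>k < l\<close> \<open>l \<le> n\<close> by auto
    ultimately show "x \<in> ?f ` {i. i \<in> D \<and> Suc i \<in> D}"
      by blast
  next
    fix x assume "x \<in> ?f ` {i. i \<in> D \<and> Suc i \<in> D}"
    then obtain i where i: "i \<in> D" "Suc i \<in> D" "x = ?f i"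
      by auto
    moreover from this have "1 \<le> i" "Suc i \<le> n"
      using D by auto
    ultimately show "x \<in> ?C"
      using cross[of i "Suc i"] by simp
  qed
  moreover have "inj_on ?f {i. i \<in> D \<and> Suc i \<in> D}"
    by (rule inj_onI) (use D in auto)
  ultimately show ?thesis
    by (simp add: cr_def card_image)
qed

section \<open>Symmetries\<close>

lemma avoids_rev:
  assumes "avoids \<sigma> [a, b, c]"
  shows "avoids (rev \<sigma>) [c, b, a]"
  unfolding avoids_length3
proof (intro allI notI)
  fix i j k
  assume occ: "1 \<le> i \<and> i < j \<and> j < k \<and> k \<le> length (rev \<sigma>) \<and>
    (val (rev \<sigma>) i < val (rev \<sigma>) j \<longleftrightarrow> c < b) \<and> (val (rev \<sigma>) j < val (rev \<sigma>) i \<longleftrightarrow> b < c) \<and>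
    (val (rev \<sigma>) i < val (rev \<sigma>) k \<longleftrightarrow> c < a) \<and> (val (rev \<sigma>) k < val (rev \<sigma>) i \<longleftrightarrow> a < c) \<and>
    (val (rev \<sigma>) j < val (rev \<sigma>) k \<longleftrightarrow> b < a) \<and> (val (rev \<sigma>) k < val (rev \<sigma>) j \<longleftrightarrow> a < b)"
  let ?r = "\<lambda>i. Suc (length \<sigma>) - i"
  have "val (rev \<sigma>) i = val \<sigma> (?r i)" "val (rev \<sigma>) j = val \<sigma> (?r j)" "val (rev \<sigma>) k = val \<sigma> (?r k)"
    using occ by (simp_all add: val_rev)
  moreover have "1 \<le> ?r k" "?r k < ?r j" "?r j < ?r i" "?r i \<le> length \<sigma>"
    using occ by auto
  ultimately show False
    using assms[unfolded avoids_length3, rule_format, of "?r k" "?r j" "?r i"] occ by metis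
qed

lemma bij_betw_rev_avoiders:
  "bij_betw rev (avoiders_n n [1, 2, 3] [1, 3, 2]) (avoiders_n n [2, 3, 1] [3, 2, 1])"
  by (rule bij_betw_byWitness[where f' = rev])
    (auto simp: avoiders_n_def rev_perms simp del: One_nat_def intro: avoids_rev)

text \<open>
The reflection of the permutation diagram in the antidiagonal, that is, the reverse complement of the
inverse: it moves the point \<open>(k, v)\<close> to \<open>(Suc n - v, Suc n - k)\<close>, as \<open>val_antitranspose\<close> states.
\<close>

definition antitranspose :: "nat list \<Rightarrow> nat list" where
  "antitranspose \<sigma> = (let n = length \<sigma> in
     map (\<lambda>i. Suc n - inv_into {1..n} (val \<sigma>) (Suc n - i)) [1..<Suc n])"

lemma val_antitranspose:
  assumes p: "\<sigma> \<in> perms n" and k: "k \<in> {1..n}"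
  shows "val (antitranspose \<sigma>) (Suc n - val \<sigma> k) = Suc n - k"
proof -
  have "inj_on (val \<sigma>) {1..n}" and v: "val \<sigma> k \<in> {1..n}"
    using p k perms_valD(2)[OF p k] by (auto simp: perms_iff bij_betw_def)
  then have "inv_into {1..n} (val \<sigma>) (Suc n - (Suc n - val \<sigma> k)) = k"
    using k by simp
  moreover have "Suc n - val \<sigma> k \<in> {1..n}"
    using v by auto
  ultimately show ?thesis
    unfolding antitranspose_def Let_def perms_valD(1)[OF p] by (subst val_map_upt) simp_all
qed

lemma obtain_position:
  assumes p: "\<sigma> \<in> perms n" and i: "i \<in> {1..n}"
  obtains k where "k \<in> {1..n}" "i = Suc n - val \<sigma> k"
proof -
  have "Suc n - i \<in> val \<sigma> ` {1..n}"
    using p i by (auto simp: perms_iff bij_betw_def)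
  then obtain k where "k \<in> {1..n}" "Suc n - i = val \<sigma> k"
    by auto
  then show ?thesis
    using that[of k] i by auto
qed

lemma antitranspose_perms:
  assumes p: "\<sigma> \<in> perms n"
  shows "antitranspose \<sigma> \<in> perms n"
proof -
  have len: "length (antitranspose \<sigma>) = n"
    using perms_valD(1)[OF p] by (simp add: antitranspose_def del: upt_Suc)
  have "{1..n} \<subseteq> val (antitranspose \<sigma>) ` {1..n}"
  proof
    fix v assume v: "v \<in> {1..n}"
    then have "Suc n - v \<in> {1..n}" by auto
    then have "Suc n - val \<sigma> (Suc n - v) \<in> {1..n}" "val (antitranspose \<sigma>) (Suc n - val \<sigma> (Suc n - v)) = v"
      using val_antitranspose[OF p, of "Suc n - v"] perms_valD(2)[OF p, of "Suc n - v"] v by auto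
    then show "v \<in> val (antitranspose \<sigma>) ` {1..n}"
      by (metis imageI)
  qed
  moreover have "val (antitranspose \<sigma>) ` {1..n} \<subseteq> {1..n}"
  proof (rule image_subsetI)
    fix i assume "i \<in> {1..n}"
    then obtain k where "k \<in> {1..n}" "i = Suc n - val \<sigma> k"
      by (rule obtain_position[OF p])
    then show "val (antitranspose \<sigma>) i \<in> {1..n}"
      using val_antitranspose[OF p, of k] by auto
  qed
  ultimately have "val (antitranspose \<sigma>) ` {1..n} = {1..n}"
    by blast
  moreover from this have "inj_on (val (antitranspose \<sigma>)) {1..n}"
    by (intro eq_card_imp_inj_on) simp_all
  ultimately show ?thesis
    by (simp add: perms_iff len bij_betw_def)
qed

lemma antitranspose_antitranspose:
  assumes p: "\<sigma> \<in> perms n"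
  shows "antitranspose (antitranspose \<sigma>) = \<sigma>"
proof (rule val_ext)
  note p' = antitranspose_perms[OF p]
  fix k assume k: "k \<in> {1..n}"
  then have v: "val \<sigma> k \<in> {1..n}"
    by (rule perms_valD(2)[OF p])
  then have "Suc n - val \<sigma> k \<in> {1..n}" by auto
  from val_antitranspose[OF p' this] show "val (antitranspose (antitranspose \<sigma>)) k = val \<sigma> k"
    using k v by (simp add: val_antitranspose[OF p k])
qed (use p antitranspose_perms in \<open>auto intro: perms_valD(1)\<close>)

text \<open>
Inversion alone turns the strict crossings above the diagonal into strict ones below, and reverse
complement alone does the same, so neither matches the weak inequality in the second kind of
crossing. Their composite maps each kind to itself. It suffices to show that crossings are mapped
injectively to crossings, because the reflection is an involution.
\<close>

lemma cr_antitranspose: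
  assumes "\<sigma> \<in> perms n"
  shows "cr (antitranspose \<sigma>) = cr \<sigma>"
proof -
  have le: "cr \<sigma> \<le> cr (antitranspose \<sigma>)" if p: "\<sigma> \<in> perms n" for \<sigma>
  proof -
    let ?f = "\<lambda>(i, j). (Suc n - val \<sigma> j, Suc n - val \<sigma> i)"
    note len = perms_valD(1)[OF p] perms_valD(1)[OF antitranspose_perms[OF p]]
    have "?f x \<in> crossings (antitranspose \<sigma>)" if x: "x \<in> crossings \<sigma>" for x
    proof -
      obtain i j where ij: "x = (i, j)" "i \<in> {1..n}" "j \<in> {1..n}"
        "i < j \<and> j < val \<sigma> i \<and> val \<sigma> i < val \<sigma> j \<or> val \<sigma> i < val \<sigma> j \<and> val \<sigma> j \<le> i \<and> i < j"
        using x by (auto simp: crossings_def len)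
      show ?thesis
        using ij perms_valD(2)[OF p ij(2)] perms_valD(2)[OF p ij(3)]
        by (auto simp: crossings_def len val_antitranspose[OF p])
    qed
    moreover have "inj_on ?f (crossings \<sigma>)"
    proof (rule inj_onI)
      fix x y assume xy: "x \<in> crossings \<sigma>" "y \<in> crossings \<sigma>" "?f x = ?f y"
      obtain i j k l where e: "x = (i, j)" "y = (k, l)"
        by (cases x, cases y)
      then have "i \<in> {1..n}" "j \<in> {1..n}" "k \<in> {1..n}" "l \<in> {1..n}"
        using xy by (auto simp: crossings_def len)
      moreover from this have "val \<sigma> i = val \<sigma> k" "val \<sigma> j = val \<sigma> l"
        using xy(3) e perms_valD(2)[OF p, of i] perms_valD(2)[OF p, of j]
          perms_valD(2)[OF p, of k] perms_valD(2)[OF p, of l] by auto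
      ultimately show "x = y"
        using perms_valD(3)[OF p] e by metis
    qed
    ultimately show ?thesis
      unfolding cr_def by (intro card_inj_on_le[of ?f]) (auto simp: finite_crossings)
  qed
  show ?thesis
    using le[OF assms] le[OF antitranspose_perms[OF assms]] antitranspose_antitranspose[OF assms]
    by simp
qed

text \<open>
Three increasing positions of the reflected word come from three decreasing values of the original
one, and the values there come from the original positions.
\<close>

lemma antitranspose_occurrence:
  assumes p: "\<sigma> \<in> perms n" and ijk: "1 \<le> i" "i < j" "j < k" "k \<le> n"
  obtains a b c where "a \<in> {1..n}" "b \<in> {1..n}" "c \<in> {1..n}"
    and "val \<sigma> c < val \<sigma> b" "val \<sigma> b < val \<sigma> a"
    and "val (antitranspose \<sigma>) i = Suc n - a" "val (antitranspose \<sigma>) j = Suc n - b"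
      "val (antitranspose \<sigma>) k = Suc n - c"
proof -
  have "i \<in> {1..n}" "j \<in> {1..n}" "k \<in> {1..n}"
    using ijk by auto
  then obtain a b c where
    a: "a \<in> {1..n}" "i = Suc n - val \<sigma> a" and
    b: "b \<in> {1..n}" "j = Suc n - val \<sigma> b" and
    c: "c \<in> {1..n}" "k = Suc n - val \<sigma> c"
    using obtain_position[OF p] by metis
  moreover have "val \<sigma> c < val \<sigma> b" "val \<sigma> b < val \<sigma> a"
    using ijk(2,3) unfolding a(2) b(2) c(2) by linarith+
  ultimately show ?thesis
    using that[of a b c] val_antitranspose[OF p] by simp
qed

lemma avoids_antitranspose:
  assumes p: "\<sigma> \<in> perms n"
  shows "avoids \<sigma> [1, 2, 3] \<Longrightarrow> avoids (antitranspose \<sigma>) [1, 2, 3]"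
    and "avoids \<sigma> [1, 3, 2] \<Longrightarrow> avoids (antitranspose \<sigma>) [2, 1, 3]"
    and "avoids \<sigma> [2, 1, 3] \<Longrightarrow> avoids (antitranspose \<sigma>) [1, 3, 2]"
proof -
  note len = perms_valD(1)[OF p] perms_valD(1)[OF antitranspose_perms[OF p]]
  let ?v = "val (antitranspose \<sigma>)"
  show "avoids (antitranspose \<sigma>) [1, 2, 3]" if av: "avoids \<sigma> [1, 2, 3]"
  proof -
    have False if ijk: "1 \<le> i" "i < j" "j < k" "k \<le> n" and v: "?v i < ?v j" "?v j < ?v k" for i j k
    proof -
      obtain a b c where "a \<in> {1..n}" "b \<in> {1..n}" "c \<in> {1..n}"
        "val \<sigma> c < val \<sigma> b" "val \<sigma> b < val \<sigma> a" "?v i = Suc n - a" "?v j = Suc n - b" "?v k = Suc n - c"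
        by (rule antitranspose_occurrence[OF p ijk])
      then show False
        using av[unfolded avoids_length3 len, rule_format, of c b a] v by auto
    qed
    then show ?thesis
      unfolding avoids_length3 len by (intro allI) force
  qed
  show "avoids (antitranspose \<sigma>) [2, 1, 3]" if av: "avoids \<sigma> [1, 3, 2]"
  proof -
    have False if ijk: "1 \<le> i" "i < j" "j < k" "k \<le> n" and v: "?v j < ?v i" "?v i < ?v k" for i j k
    proof -
      obtain a b c where "a \<in> {1..n}" "b \<in> {1..n}" "c \<in> {1..n}"
        "val \<sigma> c < val \<sigma> b" "val \<sigma> b < val \<sigma> a" "?v i = Suc n - a" "?v j = Suc n - b" "?v k = Suc n - c"
        by (rule antitranspose_occurrence[OF p ijk])
      then show False
        using av[unfolded avoids_length3 len, rule_format, of c a b] v by auto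
    qed
    then show ?thesis
      unfolding avoids_length3 len by (intro allI) force
  qed
  show "avoids (antitranspose \<sigma>) [1, 3, 2]" if av: "avoids \<sigma> [2, 1, 3]"
  proof -
    have False if ijk: "1 \<le> i" "i < j" "j < k" "k \<le> n" and v: "?v i < ?v k" "?v k < ?v j" for i j k
    proof -
      obtain a b c where "a \<in> {1..n}" "b \<in> {1..n}" "c \<in> {1..n}"
        "val \<sigma> c < val \<sigma> b" "val \<sigma> b < val \<sigma> a" "?v i = Suc n - a" "?v j = Suc n - b" "?v k = Suc n - c"
        by (rule antitranspose_occurrence[OF p ijk])
      then show False
        using av[unfolded avoids_length3 len, rule_format, of b c a] v by auto
    qed
    then show ?thesis
      unfolding avoids_length3 len by (intro allI) force
  qed
qed

lemma bij_betw_antitranspose_avoiders: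
  "bij_betw antitranspose (avoiders_n n [1, 2, 3] [1, 3, 2]) (avoiders_n n [1, 2, 3] [2, 1, 3])"
  by (rule bij_betw_byWitness[where f' = antitranspose])
    (auto simp: avoiders_n_def antitranspose_antitranspose antitranspose_perms
      simp del: One_nat_def intro: avoids_antitranspose)

section \<open>Weighted sums over subsets\<close>

text \<open>
The weight of \<open>F\<close> counts the elements above the least non-element of \<open>F\<close>.
\<close>

definition gap_sum :: "nat \<Rightarrow> int poly" where
  "gap_sum m = (\<Sum>F\<in>Pow {..<m}. q ^ card {i \<in> F. \<exists>e\<in>{..<m} - F. e < i})"

definition pair_sum :: "nat \<Rightarrow> int poly" where
  "pair_sum n = (\<Sum>D\<in>Pow {1..<n}. q ^ card {i. i \<in> D \<and> Suc i \<in> D})"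

lemma sum_Pow_insert:
  fixes f :: "'a set \<Rightarrow> 'b::comm_monoid_add"
  assumes "finite A" "a \<notin> A"
  shows "sum f (Pow (insert a A)) = sum f (Pow A) + (\<Sum>F\<in>Pow A. f (insert a F))"
proof -
  have "inj_on (insert a) (Pow A)"
    using assms(2) by (intro inj_onI) (metis PowD insert_ident subsetD)
  then show ?thesis
    using assms by (subst Pow_insert, subst sum.union_disjoint) (auto simp: sum.reindex)
qed

lemma gap_sum_0: "gap_sum 0 = 1"
  by (simp add: gap_sum_def)

text \<open>
Adding the largest element \<open>m\<close> to \<open>F\<close> raises the exponent by one, unless \<open>F\<close> is all of \<open>{..<m}\<close> and has
no gap. That one set has weight 1 instead of \<open>q\<close>, whence the correction \<open>1 - q\<close>.
\<close>

lemma gap_sum_Suc: "gap_sum (Suc m) = (1 + q) * gap_sum m + (1 - q)"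
proof -
  let ?w = "\<lambda>m F. card {i \<in> F. \<exists>e\<in>{..<m} - F. e < i}"
  have out: "?w (Suc m) F = ?w m F" if "F \<subseteq> {..<m}" for F
    using that by (intro arg_cong[where f = card] Collect_cong conj_cong refl)
      (auto, meson DiffI lessThan_iff less_trans subsetD)
  have ins: "q ^ ?w (Suc m) (insert m F) = q * q ^ ?w m F + (if F = {..<m} then 1 - q else 0)"
    if F: "F \<subseteq> {..<m}" for F
  proof (cases "F = {..<m}")
    case True
    have empty: "{i \<in> insert m F. \<exists>e\<in>{..<Suc m} - insert m F. e < i} = {}"
      "{i \<in> F. \<exists>e\<in>{..<m} - F. e < i} = {}"
      using True by auto
    show ?thesis
      unfolding empty using True by simp
  next
    case False
    then have "{i \<in> insert m F. \<exists>e\<in>{..<Suc m} - insert m F. e < i}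
        = insert m {i \<in> F. \<exists>e\<in>{..<m} - F. e < i}"
      using F by auto
    moreover have "m \<notin> F" "finite F"
      using F finite_subset by auto
    ultimately have "?w (Suc m) (insert m F) = Suc (?w m F)"
      by simp
    then show ?thesis
      using False by (simp del: mult_pCons_left)
  qed
  have "gap_sum (Suc m) = (\<Sum>F\<in>Pow {..<m}. q ^ ?w (Suc m) F)
      + (\<Sum>F\<in>Pow {..<m}. q ^ ?w (Suc m) (insert m F))"
    unfolding gap_sum_def lessThan_Suc by (rule sum_Pow_insert) auto
  also have "(\<Sum>F\<in>Pow {..<m}. q ^ ?w (Suc m) F) = gap_sum m"
    unfolding gap_sum_def by (intro sum.cong refl) (simp add: out)
  also have "(\<Sum>F\<in>Pow {..<m}. q ^ ?w (Suc m) (insert m F)) = q * gap_sum m + (1 - q)"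
    unfolding gap_sum_def sum_distrib_left
    by (subst sum.cong[OF refl ins]) (simp_all add: sum.distrib del: mult_pCons_left)
  finally show ?thesis
    by (simp add: algebra_simps del: mult_pCons_left)
qed

lemma pair_sum_0: "pair_sum 0 = 1" and pair_sum_1: "pair_sum (Suc 0) = 1"
  by (simp_all add: pair_sum_def)

text \<open>
Let \<open>T m\<close> be the part of the sum due to the sets with largest element \<open>m\<close>. Removing the largest
element \<open>Suc m\<close> of a set removes a pair of consecutive elements iff \<open>m\<close> is in the set, so
\<open>T (Suc m) = pair_sum m + q * T m\<close>, and \<open>T m = pair_sum (Suc m) - pair_sum m\<close> eliminates \<open>T\<close>.
\<close>

lemma pair_sum_Suc_Suc:
  "pair_sum (Suc (Suc n)) = (1 + q) * pair_sum (Suc n) + (1 - q) * pair_sum n"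
proof -
  define w where "w D = q ^ card {i. i \<in> D \<and> Suc i \<in> D}" for D
  \<comment> \<open>the part of the sum over the subsets of \<open>{1..<Suc m}\<close> that contain \<open>m\<close>\<close>
  define T where "T m = (\<Sum>D\<in>Pow {1..<m}. w (insert m D))" for m
  have split: "pair_sum (Suc m) = pair_sum m + T m" if "1 \<le> m" for m
  proof -
    have "{1..<Suc m} = insert m {1..<m}"
      using that by auto
    then show ?thesis
      unfolding pair_sum_def T_def w_def by (simp add: sum_Pow_insert)
  qed
  have no_pair: "w (insert (Suc m) D) = w D" if "D \<subseteq> {1..<m}" for m D
    unfolding w_def using that
    by (intro arg_cong[where f = "\<lambda>A. q ^ card A"]) auto
  have pair: "w (insert (Suc m) (insert m D)) = q * w (insert m D)" if "D \<subseteq> {1..<m}" for m D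
  proof -
    have "{i. i \<in> insert (Suc m) (insert m D) \<and> Suc i \<in> insert (Suc m) (insert m D)}
        = insert m {i. i \<in> insert m D \<and> Suc i \<in> insert m D}"
      using that by auto
    moreover have "m \<notin> {i. i \<in> insert m D \<and> Suc i \<in> insert m D}"
      using that by auto
    moreover have "finite {i. i \<in> insert m D \<and> Suc i \<in> insert m D}"
      using that finite_subset[of D "{1..<m}"] by auto
    ultimately show ?thesis
      unfolding w_def by (simp del: mult_pCons_left)
  qed
  have T: "T (Suc m) = pair_sum m + q * T m" if "1 \<le> m" for m
  proof -
    have "{1..<Suc m} = insert m {1..<m}"
      using that by auto
    then have "T (Suc m) = (\<Sum>D\<in>Pow {1..<m}. w (insert (Suc m) D))
        + (\<Sum>D\<in>Pow {1..<m}. w (insert (Suc m) (insert m D)))"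
      unfolding T_def by (simp add: sum_Pow_insert)
    also have "(\<Sum>D\<in>Pow {1..<m}. w (insert (Suc m) D)) = pair_sum m"
      unfolding pair_sum_def w_def[symmetric] by (intro sum.cong refl) (simp add: no_pair)
    also have "(\<Sum>D\<in>Pow {1..<m}. w (insert (Suc m) (insert m D))) = q * T m"
      unfolding T_def sum_distrib_left by (intro sum.cong refl) (simp add: pair del: mult_pCons_left)
    finally show ?thesis .
  qed
  show ?thesis
  proof (cases n)
    case 0
    have empty: "{i. i \<in> {Suc 0} \<and> Suc i \<in> {Suc 0}} = {}"
      by auto
    have "w {Suc 0} = 1"
      unfolding w_def empty by simp
    then have "T (Suc 0) = 1"
      by (simp add: T_def)
    then show ?thesis
      using split[of "Suc 0"] 0 by (simp add: pair_sum_0 pair_sum_1 del: mult_pCons_left)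
  next
    case (Suc m)
    then show ?thesis
      using split[of n] split[of "Suc n"] T[of n] by (simp add: algebra_simps del: mult_pCons_left)
  qed
qed

section \<open>The generating functions\<close>

lemma fps_nth_cr_gf: "fps_nth (cr_gf (avoiders \<tau>1 \<tau>2)) n = (\<Sum>\<sigma>\<in>avoiders_n n \<tau>1 \<tau>2. q ^ cr \<sigma>)"
  by (simp add: cr_gf_def avoiders_length_eq)

text \<open>
Relabelling the positions by their rank turns the statistic of \<open>cr_rise_word\<close> into that of
\<open>gap_sum\<close>. For \<open>n = 0\<close> both sides are the weight of a single object, as \<open>0 - 1 = 0\<close>.
\<close>

lemma sum_cr_123_132:
  "(\<Sum>\<sigma>\<in>avoiders_n n [1, 2, 3] [1, 3, 2]. q ^ cr \<sigma>) = gap_sum (n - 1)"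
proof -
  let ?r = "mid_rank n"
  have bij: "bij_betw ?r {1..<n} {..<n - 1}"
    by (rule bij_betw_mid_rank)
  have w: "card {i \<in> D. \<exists>e\<in>{1..<n} - D. ?r e < ?r i}
      = card {i \<in> ?r ` D. \<exists>e\<in>{..<n - 1} - ?r ` D. e < i}" if D: "D \<subseteq> {1..<n}" for D
  proof -
    have inj: "inj_on ?r {1..<n}"
      using bij by (rule bij_betw_imp_inj_on)
    have "{..<n - 1} - ?r ` D = ?r ` ({1..<n} - D)"
      using bij D inj by (simp add: inj_on_image_set_diff[of ?r "{1..<n}"] bij_betw_def)
    then have "{i \<in> ?r ` D. \<exists>e\<in>{..<n - 1} - ?r ` D. e < i}
        = ?r ` {i \<in> D. \<exists>e\<in>{1..<n} - D. ?r e < ?r i}"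
      by auto
    moreover have "inj_on ?r {i \<in> D. \<exists>e\<in>{1..<n} - D. ?r e < ?r i}"
      using inj by (rule inj_on_subset) (use D in auto)
    ultimately show ?thesis
      by (simp add: card_image)
  qed
  have "(\<Sum>\<sigma>\<in>avoiders_n n [1, 2, 3] [1, 3, 2]. q ^ cr \<sigma>) = (\<Sum>D\<in>Pow {1..<n}. q ^ cr (rise_word n D))"
    by (rule sum.reindex_bij_betw[OF bij_betw_rise_word, symmetric])
  also have "\<dots> = (\<Sum>D\<in>Pow {1..<n}. q ^ card {i \<in> ?r ` D. \<exists>e\<in>{..<n - 1} - ?r ` D. e < i})"
    by (intro sum.cong refl) (simp only: Pow_iff cr_rise_word w)
  also have "\<dots> = gap_sum (n - 1)"
    unfolding gap_sum_def by (rule sum.reindex_bij_betw[OF bij_betw_Pow[OF bij]])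
  finally show ?thesis .
qed

lemma sum_cr_123_213:
  "(\<Sum>\<sigma>\<in>avoiders_n n [1, 2, 3] [2, 1, 3]. q ^ cr \<sigma>) = gap_sum (n - 1)"
proof -
  have "(\<Sum>\<sigma>\<in>avoiders_n n [1, 2, 3] [2, 1, 3]. q ^ cr \<sigma>)
      = (\<Sum>\<sigma>\<in>avoiders_n n [1, 2, 3] [1, 3, 2]. q ^ cr (antitranspose \<sigma>))"
    by (rule sum.reindex_bij_betw[OF bij_betw_antitranspose_avoiders, symmetric])
  also have "\<dots> = gap_sum (n - 1)"
    unfolding sum_cr_123_132[symmetric]
    by (intro sum.cong refl) (simp add: avoiders_n_def cr_antitranspose[of _ n])
  finally show ?thesis .
qed

lemma sum_cr_231_321:
  "(\<Sum>\<sigma>\<in>avoiders_n n [2, 3, 1] [3, 2, 1]. q ^ cr \<sigma>) = pair_sum n"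
proof -
  have "bij_betw (rev \<circ> rise_word n) (Pow {1..<n}) (avoiders_n n [2, 3, 1] [3, 2, 1])"
    using bij_betw_rise_word bij_betw_rev_avoiders by (rule bij_betw_trans)
  then have "(\<Sum>\<sigma>\<in>avoiders_n n [2, 3, 1] [3, 2, 1]. q ^ cr \<sigma>)
      = (\<Sum>D\<in>Pow {1..<n}. q ^ cr ((rev \<circ> rise_word n) D))"
    by (rule sum.reindex_bij_betw[symmetric])
  then show ?thesis
    unfolding pair_sum_def by (simp add: cr_rev_rise_word)
qed

lemma fps_pair_recurrence:
  fixes c :: "'a::comm_ring_1" and h :: "'a fps"
  assumes "fps_nth h 0 = 1" "fps_nth h 1 = 1"
    and "\<And>n. fps_nth h (Suc (Suc n)) = (1 + c) * fps_nth h (Suc n) + (1 - c) * fps_nth h n"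
  shows "(1 - (1 + fps_const c) * fps_X - (1 - fps_const c) * fps_X ^ 2) * h = 1 - fps_const c * fps_X"
proof -
  have "(1 - (1 + fps_const c) * fps_X - (1 - fps_const c) * fps_X ^ 2) * h
      = h - fps_X * h - fps_const c * (fps_X * h) - fps_X * (fps_X * h)
        + fps_const c * (fps_X * (fps_X * h))"
    by (simp add: algebra_simps power2_eq_square)
  also have "\<dots> = 1 - fps_const c * fps_X"
  proof (rule fps_ext)
    fix n
    consider "n = 0" | "n = 1" | m where "n = Suc (Suc m)"
      by (metis One_nat_def not0_implies_Suc)
    then show "fps_nth (h - fps_X * h - fps_const c * (fps_X * h) - fps_X * (fps_X * h)
        + fps_const c * (fps_X * (fps_X * h))) n = fps_nth (1 - fps_const c * fps_X) n"
      by cases (use assms in \<open>simp_all add: algebra_simps\<close>)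
  qed
  finally show ?thesis .
qed

lemma fps_gap_recurrence:
  fixes c :: "'a::comm_ring_1" and h :: "'a fps"
  assumes "fps_nth h 0 = 1" "fps_nth h 1 = 1"
    and "\<And>n. fps_nth h (Suc (Suc n)) = (1 + c) * fps_nth h (Suc n) + (1 - c)"
  shows "(1 - fps_X) * (1 - (1 + fps_const c) * fps_X) * (h - 1) = (1 - fps_const c * fps_X) * fps_X"
proof -
  \<comment> \<open>the factor \<open>1 - (1 + c) X\<close> cancels the homogeneous part of the recurrence; what is left has
    constant coefficients from degree 2 on, and the factor \<open>1 - X\<close> cancels those\<close>
  define g where "g = Abs_fps (\<lambda>n. if n = 0 then 0 else if n = 1 then 1 else 1 - c)"
  have "(1 - (1 + fps_const c) * fps_X) * (h - 1) = (h - 1) - fps_X * (h - 1) - fps_const c * (fps_X * (h - 1))"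
    by (simp add: algebra_simps)
  also have "\<dots> = g"
  proof (rule fps_ext)
    fix n
    consider "n = 0" | "n = 1" | m where "n = Suc (Suc m)"
      by (metis One_nat_def not0_implies_Suc)
    then show "fps_nth ((h - 1) - fps_X * (h - 1) - fps_const c * (fps_X * (h - 1))) n = fps_nth g n"
      by cases (use assms in \<open>simp_all add: g_def algebra_simps\<close>)
  qed
  finally have 1: "(1 - (1 + fps_const c) * fps_X) * (h - 1) = g" .
  have "(1 - fps_X) * g = g - fps_X * g"
    by (simp add: algebra_simps)
  also have "\<dots> = fps_X - fps_const c * (fps_X * fps_X)"
  proof (rule fps_ext)
    fix n
    consider "n = 0" | "n = 1" | "n = 2" | m where "n = Suc (Suc (Suc m))"
      by (metis One_nat_def Suc_1 not0_implies_Suc)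
    then show "fps_nth (g - fps_X * g) n = fps_nth (fps_X - fps_const c * (fps_X * fps_X)) n"
      by cases (simp_all add: g_def)
  qed
  also have "\<dots> = (1 - fps_const c * fps_X) * fps_X"
    by (simp add: algebra_simps)
  finally show ?thesis
    by (simp add: 1 mult.assoc)
qed

theorem theorem2:
  shows "cr_gf (avoiders [2, 3, 1] [3, 2, 1]) =
      fps_quot (1 - fps_const q * fps_X)
        (1 - (1 + fps_const q) * fps_X - (1 - fps_const q) * fps_X ^ 2) \<and>
    (\<forall>\<tau>\<in>{[1, 3, 2], [2, 1, 3]}.
      cr_gf (avoiders [1, 2, 3] \<tau>) =
        1 + fps_quot ((1 - fps_const q * fps_X) * fps_X)
              ((1 - fps_X) * (1 - (1 + fps_const q) * fps_X)))"
proof (intro conjI ballI)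
  show "cr_gf (avoiders [2, 3, 1] [3, 2, 1]) =
      fps_quot (1 - fps_const q * fps_X)
        (1 - (1 + fps_const q) * fps_X - (1 - fps_const q) * fps_X ^ 2)"
  proof (subst fps_quot_unique)
    have "fps_nth (cr_gf (avoiders [2, 3, 1] [3, 2, 1])) n = pair_sum n" for n
      unfolding fps_nth_cr_gf by (rule sum_cr_231_321)
    then show "(1 - (1 + fps_const q) * fps_X - (1 - fps_const q) * fps_X ^ 2)
        * cr_gf (avoiders [2, 3, 1] [3, 2, 1]) = 1 - fps_const q * fps_X"
      by (intro fps_pair_recurrence)
        (simp_all only: pair_sum_0 pair_sum_1 pair_sum_Suc_Suc One_nat_def)
  qed simp
next
  fix \<tau> :: "nat list" assume "\<tau> \<in> {[1, 3, 2], [2, 1, 3]}"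
  then have nth: "fps_nth (cr_gf (avoiders [1, 2, 3] \<tau>)) n = gap_sum (n - 1)" for n
    using sum_cr_123_132[of n] sum_cr_123_213[of n] unfolding fps_nth_cr_gf by blast
  let ?h = "cr_gf (avoiders [1, 2, 3] \<tau>)"
  have "(1 - fps_X) * (1 - (1 + fps_const q) * fps_X) * (?h - 1) = (1 - fps_const q * fps_X) * fps_X"
    by (rule fps_gap_recurrence; simp only: nth) (simp_all add: gap_sum_0 gap_sum_Suc del: mult_pCons_left)
  then have "?h - 1 = fps_quot ((1 - fps_const q * fps_X) * fps_X)
      ((1 - fps_X) * (1 - (1 + fps_const q) * fps_X))"
    by (subst fps_quot_unique) simp_all
  then show "?h = 1 + fps_quot ((1 - fps_const q * fps_X) * fps_X)
      ((1 - fps_X) * (1 - (1 + fps_const q) * fps_X))"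
    by (simp add: algebra_simps)
qed

end
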